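(* Let $X\in\mathcal X$ have conditional density $p(\cdot\mid\theta)$ given $\theta\in\Theta\subset\mathbb R$, where $\theta\sim G$. Suppose that $G$ has a density $g$ with respect to Lebesgue measure on $\Theta$, and let $\pi(\theta\mid x)=p(x\mid\theta)g(\theta)/p_G(x)$ be the posterior density. For $0<\beta<1$ define $$k^*:=\sup\big\{k\ge0:\ \mathbb P_G(\pi(\theta\mid X)\ge k)\ge1-\beta\big\}.$$ Then $$\mathbb P_G(\pi(\theta\mid X)>k^* )\le1-\beta\le\mathbb P_G(\pi(\theta\mid X)\ge k^* ).$$ Moreover, there exists a measurable set $A^*\subseteq\{(x,\theta)\in\mathcal X\times\Theta:\pi(\theta\mid x)=k^*\}$ such that the measurable set-valued rule $$\mathcal I^*(x):=\{\theta\in\Theta:\pi(\theta\mid x)>k^*\}\cup\{\theta\in\Theta:(x,\theta)\in A^*\}$$ solves the optimization problem $$\min_{I(\cdot)}\ \mathbb E_G\big[|I(X)|\big]\quad\text{subject to}\quad\mathbb P_G(\theta\in I(X))\ge1-\beta$$ over set-valued rules $I:x\mapsto I(x)\subset\Theta$, and $\mathbb P_G(\theta\in\mathcal I^*(X))=1-\beta$.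
   Context: $\mathbb E_G,\mathbb P_G$ denote expectation and probability under $\theta\sim G$, $X\mid\theta\sim p(\cdot\mid\theta)$. The density $p(\cdot\mid\theta)$ is with respect to a reference measure on $\mathcal X$ written $dx$, and $p_G(x)=\int p(x\mid\theta)g(\theta)\,d\theta$ is the marginal density of $X$. For a set-valued rule $I:x\mapsto I(x)\subset\Theta$, $|I(x)|$ is the Lebesgue measure of $I(x)$; a rule is identified with the (measurable) set $\{(x,\theta)\in\mathcal X\times\Theta:\theta\in I(x)\}$. *)

theory Defs
  imports "HOL-Probability.Probability"
begin

abbreviation leb_on :: "real set \<Rightarrow> real measure"
  where "leb_on \<Theta> \<equiv> restrict_space lborel \<Theta>"

text \<open>The joint law of the pair \<open>(X, \<theta>)\<close> under \<open>\<theta> \<sim> G\<close>, \<open>X | \<theta> \<sim> p(\<cdot> | \<theta>)\<close>, where \<open>M\<close> is the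
  sample space with its reference measure \<open>dx\<close>. The density \<open>p(x | \<theta>)\<close> is written \<open>p x \<theta>\<close>.\<close>

definition joint_law ::
  "'x measure \<Rightarrow> real set \<Rightarrow> ('x \<Rightarrow> real \<Rightarrow> real) \<Rightarrow> real measure \<Rightarrow> ('x \<times> real) measure"
  where "joint_law M \<Theta> p G =
    do { \<theta> \<leftarrow> G; x \<leftarrow> density M (\<lambda>x. ennreal (p x \<theta>)); return (M \<Otimes>\<^sub>M leb_on \<Theta>) (x, \<theta>) }"

definition marginal_density ::
  "real set \<Rightarrow> ('x \<Rightarrow> real \<Rightarrow> real) \<Rightarrow> (real \<Rightarrow> real) \<Rightarrow> 'x \<Rightarrow> real"
  where "marginal_density \<Theta> p g x = (LINT \<theta>|leb_on \<Theta>. p x \<theta> * g \<theta>)"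

text \<open>Where the marginal density is zero or infinite, which happens with probability zero, the
  posterior density is zero by the conventions for division and for the integral.\<close>

definition posterior ::
  "real set \<Rightarrow> ('x \<Rightarrow> real \<Rightarrow> real) \<Rightarrow> (real \<Rightarrow> real) \<Rightarrow> real \<Rightarrow> 'x \<Rightarrow> real"
  where "posterior \<Theta> p g \<theta> x = p x \<theta> * g \<theta> / marginal_density \<Theta> p g x"

text \<open>The set below contains 0, and it is bounded above for a proper model and \<open>\<beta> < 1\<close>, so the
  real supremum is the intended one.\<close>

definition kstar ::
  "'x measure \<Rightarrow> real set \<Rightarrow> ('x \<Rightarrow> real \<Rightarrow> real) \<Rightarrow> real measure \<Rightarrow> (real \<Rightarrow> real) \<Rightarrow> real \<Rightarrow> real"
  where "kstar M \<Theta> p G g \<beta> =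
    Sup {k. 0 \<le> k \<and> \<P>((x, \<theta>) in joint_law M \<Theta> p G. posterior \<Theta> p g \<theta> x \<ge> k) \<ge> 1 - \<beta>}"

text \<open>Values of a rule outside \<open>space M\<close> are irrelevant; \<open>Sigma (space M) I\<close> is the set
  \<open>{(x, \<theta>). \<theta> \<in> I x}\<close> with which the rule \<open>I\<close> is identified.\<close>

definition set_rules :: "'x measure \<Rightarrow> real set \<Rightarrow> ('x \<Rightarrow> real set) set"
  where "set_rules M \<Theta> =
    {I. (\<forall>x\<in>space M. I x \<subseteq> \<Theta>) \<and> Sigma (space M) I \<in> sets (M \<Otimes>\<^sub>M leb_on \<Theta>)}"

definition coverage ::
  "'x measure \<Rightarrow> real set \<Rightarrow> ('x \<Rightarrow> real \<Rightarrow> real) \<Rightarrow> real measure \<Rightarrow> ('x \<Rightarrow> real set) \<Rightarrow> real"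
  where "coverage M \<Theta> p G I = \<P>((x, \<theta>) in joint_law M \<Theta> p G. \<theta> \<in> I x)"

text \<open>Lengths may be infinite, so the expectation is taken in \<open>[0, \<infinity>]\<close>.\<close>

definition expected_length ::
  "'x measure \<Rightarrow> real set \<Rightarrow> ('x \<Rightarrow> real \<Rightarrow> real) \<Rightarrow> real measure \<Rightarrow> ('x \<Rightarrow> real set) \<Rightarrow> ennreal"
  where "expected_length M \<Theta> p G I = (\<integral>\<^sup>+ (x, \<theta>). emeasure lborel (I x) \<partial>joint_law M \<Theta> p G)"

end

theory Submission
  imports Defs
begin

text \<open>
  The problem is a Neyman--Pearson problem. Write \<open>m\<close> for the marginal density of the data and
  let \<open>\<mu>\<close> be the measure \<open>m(x) dx d\<theta>\<close> (\<open>data_length\<close> below). Two identities translate the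
  statement: the joint law of \<open>(X, \<theta>)\<close> has the posterior density \<open>\<pi>\<close> as its density with respect to
  \<open>\<mu>\<close> (\<open>joint_density_posterior\<close>), and the expected length of a rule is the \<open>\<mu>\<close>-measure of the
  region it describes (\<open>expected_length_eq\<close>, by Tonelli). Thus one looks for the
  region of least \<open>\<mu>\<close>-measure among those of \<open>\<pi> \<mu>\<close>-measure at least \<open>1 - \<beta>\<close>.

  If \<open>I\<close> lies between \<open>{\<pi> > k}\<close> and \<open>{\<pi> \<ge> k}\<close> with \<open>k > 0\<close>, every part of another region \<open>J\<close> outside
  \<open>I\<close> costs at least \<open>1/k\<close> units of \<open>\<mu>\<close> per unit of probability, and every part of \<open>I\<close>
  outside \<open>J\<close> costs at most that. So \<open>J\<close> cannot reach the probability of \<open>I\<close> at smaller \<open>\<mu>\<close>-measure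
  (\<open>superlevel_set_minimal\<close>).

  It remains to find such an \<open>I\<close> with probability exactly \<open>1 - \<beta>\<close>. The two inequalities
  around \<open>1 - \<beta>\<close> are the one-sided continuity of the tail function of \<open>\<pi>\<close> at its quantile
  \<open>k\<^sup>*\<close> (\<open>upper_quantile\<close>). Because the parameter has a Lebesgue density, the level set
  \<open>{\<pi> = k\<^sup>*}\<close> can be cut at a value of \<open>\<theta>\<close> so as to fill the gap exactly
  (\<open>exists_subset_of_measure\<close>). Finally \<open>k\<^sup>* > 0\<close>, since \<open>\<pi> > 0\<close> almost surely
  (\<open>AE_posterior_pos\<close>) while \<open>\<pi> > k\<^sup>*\<close> has probability at most \<open>1 - \<beta> < 1\<close>.
\<close>

section \<open>Upper quantiles of a probability measure\<close>

text \<open>The tail probability of \<open>f\<close> at \<open>t\<close> decreases in \<open>t\<close>, is at least \<open>c\<close> left of the supremum and at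
  most \<open>c\<close> right of it; letting \<open>t\<close> tend to \<open>k\<close> from either side turns \<open>f \<ge> t\<close> into \<open>f \<ge> k\<close> and
  \<open>f > k\<close> respectively. The real supremum is meaningful because the tail vanishes at
  infinity, below the positive level \<open>c\<close>.\<close>

lemma (in prob_space) upper_quantile:
  fixes f :: "'a \<Rightarrow> real"
  assumes [measurable]: "f \<in> borel_measurable M" and nonneg: "\<And>x. x \<in> space M \<Longrightarrow> 0 \<le> f x"
    and c: "0 < c" "c \<le> 1"
    and k: "k = Sup {k. 0 \<le> k \<and> c \<le> \<P>(x in M. k \<le> f x)}"
  shows "\<P>(x in M. k < f x) \<le> c" and "c \<le> \<P>(x in M. k \<le> f x)" and "0 \<le> k"
proof -
  define K where "K = {k. 0 \<le> k \<and> c \<le> \<P>(x in M. k \<le> f x)}"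
  have K0: "0 \<in> K"
    using nonneg c prob_space by (simp add: K_def cong: conj_cong)
  have "(\<lambda>n. \<P>(x in M. real n \<le> f x)) \<longlonglongrightarrow> measure M (\<Inter>n. {x\<in>space M. real n \<le> f x})"
    by (rule finite_Lim_measure_decseq) (auto simp: decseq_def)
  also have "(\<Inter>n. {x\<in>space M. real n \<le> f x}) = {}"
    by auto (meson not_le reals_Archimedean2)
  finally have "eventually (\<lambda>n. \<P>(x in M. real n \<le> f x) < c) sequentially"
    using c by (intro order_tendstoD) auto
  then obtain n where n: "\<P>(x in M. real n \<le> f x) < c"
    by (auto simp: eventually_sequentially)
  have bdd: "bdd_above K"
  proof (rule bdd_aboveI)
    fix t assume t: "t \<in> K"
    show "t \<le> real n"
    proof (rule ccontr)
      assume "\<not> t \<le> real n"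
      then have "\<P>(x in M. t \<le> f x) \<le> \<P>(x in M. real n \<le> f x)"
        by (intro finite_measure_mono) auto
      with n t show False by (auto simp: K_def)
    qed
  qed
  have k: "k = Sup K" using k by (simp add: K_def)
  show "0 \<le> k" unfolding k using K0 bdd by (rule cSup_upper)
  have below: "c \<le> \<P>(x in M. t \<le> f x)" if "t < k" for t
  proof -
    from that obtain s where "s \<in> K" "t < s"
      unfolding k using less_cSup_iff[OF _ bdd] K0 by (metis empty_iff)
    then have "c \<le> \<P>(x in M. s \<le> f x)" "\<P>(x in M. s \<le> f x) \<le> \<P>(x in M. t \<le> f x)"
      by (auto simp: K_def intro!: finite_measure_mono)
    then show ?thesis by simp
  qed
  have above: "\<P>(x in M. t \<le> f x) \<le> c" if "k < t" for t
  proof (rule ccontr)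
    assume "\<not> ?thesis"
    then have "t \<in> K" using that \<open>0 \<le> k\<close> by (auto simp: K_def)
    then show False using cSup_upper[OF _ bdd] that k by fastforce
  qed
  have step: "1 / real (Suc n) \<le> 1 / real (Suc m)" if "m \<le> n" for m n
    using that by (simp add: frac_le)
  have "(\<lambda>n. \<P>(x in M. k - 1 / real (Suc n) \<le> f x))
      \<longlonglongrightarrow> measure M (\<Inter>n. {x\<in>space M. k - 1 / real (Suc n) \<le> f x})"
  proof (rule finite_Lim_measure_decseq)
    show "decseq (\<lambda>n. {x\<in>space M. k - 1 / real (Suc n) \<le> f x})"
      unfolding decseq_def
    proof (intro allI impI subsetI CollectI conjI)
      fix m n x assume "m \<le> n" and "x \<in> {x\<in>space M. k - 1 / real (Suc n) \<le> f x}"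
      with step[of m n] show "x \<in> space M" "k - 1 / real (Suc m) \<le> f x"
        by (simp_all del: of_nat_Suc)
    qed
  qed auto
  also have "(\<Inter>n. {x\<in>space M. k - 1 / real (Suc n) \<le> f x}) = {x\<in>space M. k \<le> f x}"
  proof (intro set_eqI iffI)
    fix x assume "x \<in> (\<Inter>n. {x\<in>space M. k - 1 / real (Suc n) \<le> f x})"
    then have x: "x \<in> space M" and close: "k - 1 / real (Suc n) \<le> f x" for n
      by blast+
    have "k \<le> f x"
    proof (rule field_le_epsilon)
      fix e :: real assume "0 < e"
      then obtain n where "1 / real (Suc n) < e"
        using reals_Archimedean[of e] unfolding inverse_eq_divide by blast
      with close[of n] show "k \<le> f x + e" by linarith
    qed
    with x show "x \<in> {x\<in>space M. k \<le> f x}" by simp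
  next
    fix x assume x: "x \<in> {x\<in>space M. k \<le> f x}"
    have "k - 1 / real (Suc n) \<le> f x" for n
      using x order_trans[of "k - 1 / real (Suc n)" k "f x"] by simp
    with x show "x \<in> (\<Inter>n. {x\<in>space M. k - 1 / real (Suc n) \<le> f x})" by blast
  qed
  finally show "c \<le> \<P>(x in M. k \<le> f x)"
    by (rule LIMSEQ_le_const) (intro exI[of _ 0] allI impI below, simp)
  have "(\<lambda>n. \<P>(x in M. k + 1 / real (Suc n) \<le> f x))
      \<longlonglongrightarrow> measure M (\<Union>n. {x\<in>space M. k + 1 / real (Suc n) \<le> f x})"
  proof (rule finite_Lim_measure_incseq)
    show "incseq (\<lambda>n. {x\<in>space M. k + 1 / real (Suc n) \<le> f x})"
      unfolding incseq_def
    proof (intro allI impI subsetI CollectI conjI)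
      fix m n x assume "m \<le> n" and "x \<in> {x\<in>space M. k + 1 / real (Suc m) \<le> f x}"
      with step[of m n] show "x \<in> space M" "k + 1 / real (Suc n) \<le> f x"
        by (simp_all del: of_nat_Suc)
    qed
  qed auto
  also have "(\<Union>n. {x\<in>space M. k + 1 / real (Suc n) \<le> f x}) = {x\<in>space M. k < f x}"
  proof (intro set_eqI iffI)
    fix x assume x: "x \<in> {x\<in>space M. k < f x}"
    then obtain n where "1 / real (Suc n) < f x - k"
      using reals_Archimedean[of "f x - k"] unfolding inverse_eq_divide by auto
    then have "k + 1 / real (Suc n) \<le> f x" by linarith
    with x show "x \<in> (\<Union>n. {x\<in>space M. k + 1 / real (Suc n) \<le> f x})" by blast
  next
    fix x assume "x \<in> (\<Union>n. {x\<in>space M. k + 1 / real (Suc n) \<le> f x})"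
    then obtain n where x: "x \<in> space M" and n: "k + 1 / real (Suc n) \<le> f x" by blast
    have "k < k + 1 / real (Suc n)" by simp
    with n have "k < f x" by (rule less_le_trans[rotated])
    with x show "x \<in> {x\<in>space M. k < f x}" by simp
  qed
  finally show "\<P>(x in M. k < f x) \<le> c"
    by (rule LIMSEQ_le_const2) (intro exI[of _ 0] allI impI above, simp)
qed

section \<open>Splitting a set along a continuously distributed coordinate\<close>

text \<open>The measure of \<open>{x \<in> S. h x \<le> t}\<close> is the distribution function of \<open>h\<close> restricted to \<open>S\<close>. When
  \<open>h\<close> has no atoms this is continuous in \<open>t\<close> and runs from \<open>0\<close> to the measure of \<open>S\<close>, so it takes every
  value strictly between by the intermediate value theorem.\<close>

lemma (in finite_measure) exists_subset_of_measure:
  fixes h :: "'a \<Rightarrow> real"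
  assumes [measurable]: "h \<in> borel_measurable M" "S \<in> sets M"
    and null: "\<And>t. measure M {x\<in>space M. h x = t} = 0"
    and c: "0 \<le> c" "c \<le> measure M S"
  obtains A where "A \<in> sets M" "A \<subseteq> S" "measure M A = c"
  \<comment> \<open>The two extreme values may be attained only in the limits \<open>t \<rightarrow> \<plusminus>\<infinity>\<close>, so they are treated apart.\<close>
proof (cases "c = 0 \<or> c = measure M S")
  case True
  with that[of "{}"] that[of S] show ?thesis by auto
next
  case False
  define D where "D = distr (restrict_space M S) borel h"
  have S: "S \<subseteq> space M" by (rule sets.sets_into_space) fact
  have hS[measurable]: "h \<in> borel_measurable (restrict_space M S)"
    by (rule measurable_restrict_space1) fact
  have D: "measure D B = measure M {x\<in>S. h x \<in> B}" if [measurable]: "B \<in> sets borel" for B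
  proof -
    have "measure D B = measure (restrict_space M S) (h -` B \<inter> space (restrict_space M S))"
      by (simp add: D_def measure_distr)
    also have "h -` B \<inter> space (restrict_space M S) = {x\<in>S. h x \<in> B}"
      using S by (auto simp: space_restrict_space)
    finally show ?thesis using S by (simp add: measure_restrict_space)
  qed
  interpret S: finite_measure "restrict_space M S"
    by (rule finite_measure_restrict_space) (use finite_measure_axioms in auto)
  have "finite_measure D"
    unfolding D_def by (rule S.finite_measure_distr) simp
  then interpret D: finite_borel_measure D
    by (simp add: finite_borel_measure_def finite_borel_measure_axioms_def D_def)
  have "isCont (cdf D) t" for t
  proof -
    have "measure D {t} \<le> measure M {x\<in>space M. h x = t}"
      using S by (subst D) (auto intro!: finite_measure_mono)
    then show ?thesis
      unfolding D.isCont_cdf using null[of t] by (simp add: order_antisym)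
  qed
  then have cont: "continuous_on UNIV (cdf D)"
    by (simp add: continuous_on_eq_continuous_at)
  have tot: "measure D (space D) = measure M S"
    by (simp add: D D.borel_UNIV)
  have "eventually (\<lambda>t. cdf D t < c) at_bot"
    using D.cdf_lim_at_bot c False by (intro order_tendstoD) auto
  then obtain a where a: "\<And>t. t \<le> a \<Longrightarrow> cdf D t < c"
    by (auto simp: eventually_at_bot_linorder)
  have "eventually (\<lambda>t. c < cdf D t) at_top"
    using D.cdf_lim_at_top c False by (intro order_tendstoD) (auto simp: tot)
  then obtain b where b: "\<And>t. t \<ge> b \<Longrightarrow> c < cdf D t"
    by (auto simp: eventually_at_top_linorder)
  have "a \<le> b" using a[of b] b[of b] by fastforce
  obtain t where "cdf D t = c"
    using IVT'[of "cdf D" a c b] a[of a] b[of b] \<open>a \<le> b\<close> continuous_on_subset[OF cont]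
    by (meson less_imp_le order_refl subset_UNIV)
  then have "measure M {x\<in>S. h x \<le> t} = c" by (simp add: cdf_def D)
  moreover have "{x\<in>S. h x \<le> t} \<in> sets M"
  proof -
    have "{x\<in>S. h x \<le> t} = S \<inter> {x\<in>space M. h x \<le> t}" using S by auto
    also have "\<dots> \<in> sets M" by measurable
    finally show ?thesis .
  qed
  ultimately show ?thesis using that[of "{x\<in>S. h x \<le> t}"] by auto
qed

section \<open>Superlevel sets of a density have minimal measure\<close>

text \<open>This is the optimality half of the Neyman--Pearson lemma. Only \<open>I - J\<close> and \<open>J - I\<close> matter:
  on the first \<open>f \<ge> k\<close>, on the second \<open>f \<le> k\<close>, and comparing both with \<open>k\<close> times \<open>M\<close> carries the
  inequality over from \<open>density M f\<close> to \<open>M\<close>.\<close>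

lemma superlevel_set_minimal:
  fixes f :: "'a \<Rightarrow> real"
  assumes f[measurable]: "f \<in> borel_measurable M" and "0 < k"
    and I[measurable]: "I \<in> sets M" and J[measurable]: "J \<in> sets M"
    and above: "\<And>x. x \<in> I \<Longrightarrow> k \<le> f x" and below: "\<And>x. x \<in> space M - I \<Longrightarrow> f x \<le> k"
    and le: "emeasure (density M f) I \<le> emeasure (density M f) J"
    and fin: "emeasure (density M f) I < \<infinity>"
  shows "emeasure M I \<le> emeasure M J"
proof -
  let ?P = "density M f"
  have split: "emeasure N A = emeasure N (A \<inter> B) + emeasure N (A - B)"
    if "A \<in> sets N" "B \<in> sets N" for N :: "'a measure" and A B
    using that by (subst plus_emeasure) (auto intro!: arg_cong[of _ _ "emeasure N"])
  have "ennreal k * emeasure M (I - J) = (\<integral>\<^sup>+x. ennreal k * indicator (I - J) x \<partial>M)"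
    by (simp add: nn_integral_cmult_indicator)
  also have "\<dots> \<le> emeasure ?P (I - J)"
    by (subst emeasure_density)
       (auto intro!: nn_integral_mono ennreal_leI above split: split_indicator)
  also have "\<dots> \<le> emeasure ?P (J - I)"
  proof -
    have "emeasure ?P (I \<inter> J) + emeasure ?P (I - J) \<le> emeasure ?P (I \<inter> J) + emeasure ?P (J - I)"
      using le split[of I ?P J] split[of J ?P I] by (simp add: Int_commute)
    moreover have "emeasure ?P (I \<inter> J) < \<infinity>"
      using fin by (rule le_less_trans[rotated]) (auto intro!: emeasure_mono)
    ultimately show ?thesis by (auto simp: ennreal_add_left_cancel_le)
  qed
  also have "\<dots> \<le> (\<integral>\<^sup>+x. ennreal k * indicator (J - I) x \<partial>M)"
    using sets.sets_into_space[OF J]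
    by (subst emeasure_density)
       (auto intro!: nn_integral_mono ennreal_leI below split: split_indicator)
  also have "\<dots> = ennreal k * emeasure M (J - I)"
    by (simp add: nn_integral_cmult_indicator)
  \<comment> \<open>Here \<open>k > 0\<close> is essential: it allows cancelling the factor \<open>k\<close>.\<close>
  finally have "emeasure M (I - J) \<le> emeasure M (J - I)"
    using \<open>0 < k\<close> by (simp add: ennreal_mult_le_mult_iff)
  then show ?thesis
    using split[of I M J] split[of J M I] by (simp add: Int_commute add_left_mono)
qed

section \<open>The joint law of data and parameter\<close>

locale bayes_model =
  fixes M :: "'x measure" and \<Theta> :: "real set"
    and p :: "'x \<Rightarrow> real \<Rightarrow> real" and g :: "real \<Rightarrow> real"
  assumes sigma_finite_M: "sigma_finite_measure M"
    and Theta_borel: "\<Theta> \<in> sets borel"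
    and p_measurable: "(\<lambda>(x, \<theta>). p x \<theta>) \<in> borel_measurable (M \<Otimes>\<^sub>M leb_on \<Theta>)"
    and p_nonneg: "\<And>x \<theta>. x \<in> space M \<Longrightarrow> \<theta> \<in> \<Theta> \<Longrightarrow> 0 \<le> p x \<theta>"
    and prob_p: "\<And>\<theta>. \<theta> \<in> \<Theta> \<Longrightarrow> prob_space (density M (\<lambda>x. ennreal (p x \<theta>)))"
    and g_measurable[measurable]: "g \<in> borel_measurable (leb_on \<Theta>)"
    and g_nonneg: "\<And>\<theta>. \<theta> \<in> \<Theta> \<Longrightarrow> 0 \<le> g \<theta>"
    and prob_prior: "prob_space (density (leb_on \<Theta>) (\<lambda>\<theta>. ennreal (g \<theta>)))"
begin

abbreviation N where "N \<equiv> M \<Otimes>\<^sub>M leb_on \<Theta>"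
abbreviation prior where "prior \<equiv> density (leb_on \<Theta>) (\<lambda>\<theta>. ennreal (g \<theta>))"
abbreviation joint where "joint \<equiv> joint_law M \<Theta> p prior"
abbreviation marg where "marg \<equiv> marginal_density \<Theta> p g"
abbreviation post where "post \<equiv> posterior \<Theta> p g"

lemma space_leb_on[simp]: "space (leb_on \<Theta>) = \<Theta>"
  by (simp add: space_restrict_space)

sublocale pair_sigma_finite M "leb_on \<Theta>"
proof -
  interpret sigma_finite_measure M by (rule sigma_finite_M)
  interpret L: sigma_finite_measure "leb_on \<Theta>"
    by (rule sigma_finite_measure_restrict_space)
       (use Theta_borel lborel.sigma_finite_measure_axioms in auto)
  show "pair_sigma_finite M (leb_on \<Theta>)" ..
qed

lemma p_measurable'[measurable (raw)]:
  assumes [measurable]: "f \<in> L \<rightarrow>\<^sub>M M" "h \<in> L \<rightarrow>\<^sub>M leb_on \<Theta>"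
  shows "(\<lambda>w. p (f w) (h w)) \<in> borel_measurable L"
  using measurable_compose[OF measurable_Pair[OF assms] p_measurable] by simp

lemma marg_measurable[measurable]: "marg \<in> borel_measurable M"
  unfolding marginal_density_def by measurable

lemma post_measurable[measurable]: "(\<lambda>(x, \<theta>). post \<theta> x) \<in> borel_measurable N"
  unfolding posterior_def by measurable

lemma marg_nonneg: "x \<in> space M \<Longrightarrow> 0 \<le> marg x"
  unfolding marginal_density_def by (rule integral_nonneg_AE) (auto simp: p_nonneg g_nonneg)

lemma post_nonneg: "x \<in> space M \<Longrightarrow> \<theta> \<in> \<Theta> \<Longrightarrow> 0 \<le> post \<theta> x"
  unfolding posterior_def by (simp add: p_nonneg g_nonneg marg_nonneg)

text \<open>Sampling \<open>\<theta>\<close> and then \<open>x\<close> integrates first over \<open>x\<close> and then over \<open>\<theta>\<close>; by Tonelli this is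
  integration against the product of the reference measures.\<close>

lemma joint_law_density: "joint = density N (\<lambda>(x, \<theta>). ennreal (p x \<theta> * g \<theta>))"
proof -
  interpret prior: prob_space prior by (rule prob_prior)
  define K where "K \<theta> = (density M (\<lambda>x. ennreal (p x \<theta>))) \<bind> (\<lambda>x. return N (x, \<theta>))" for \<theta>
  have K: "K \<theta> = distr (density M (\<lambda>x. ennreal (p x \<theta>))) N (\<lambda>x. (x, \<theta>))" if "\<theta> \<in> \<Theta>" for \<theta>
  proof -
    interpret prob_space "density M (\<lambda>x. ennreal (p x \<theta>))" by (rule prob_p) fact
    show ?thesis
      unfolding K_def using that not_empty by (subst bind_return_distr[symmetric]) (auto simp: comp_def)
  qed
  have emeasure_K: "emeasure (K \<theta>) A = (\<integral>\<^sup>+x. ennreal (p x \<theta>) * indicator A (x, \<theta>) \<partial>M)"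
    if "\<theta> \<in> \<Theta>" and [measurable]: "A \<in> sets N" for \<theta> A
  proof -
    have "emeasure (K \<theta>) A = emeasure (density M (\<lambda>x. ennreal (p x \<theta>))) ((\<lambda>x. (x, \<theta>)) -` A \<inter> space M)"
      using that by (simp add: K emeasure_distr)
    also have "\<dots> = (\<integral>\<^sup>+x. ennreal (p x \<theta>) * indicator ((\<lambda>x. (x, \<theta>)) -` A \<inter> space M) x \<partial>M)"
      using that by (subst emeasure_density) auto
    also have "\<dots> = (\<integral>\<^sup>+x. ennreal (p x \<theta>) * indicator A (x, \<theta>) \<partial>M)"
      by (rule nn_integral_cong) (auto split: split_indicator)
    finally show ?thesis .
  qed
  have K_meas: "K \<in> prior \<rightarrow>\<^sub>M subprob_algebra N"
  proof (rule measurable_subprob_algebra)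
    fix \<theta> assume "\<theta> \<in> space prior"
    then have \<theta>: "\<theta> \<in> \<Theta>" by simp
    interpret prob_space "density M (\<lambda>x. ennreal (p x \<theta>))" by (rule prob_p) fact
    show "sets (K \<theta>) = sets N" using \<theta> by (simp add: K)
    show "subprob_space (K \<theta>)"
      unfolding K[OF \<theta>] using \<theta> 
      by (intro prob_space_imp_subprob_space prob_space_distr) auto
  next
    fix A assume [measurable]: "A \<in> sets N"
    have "(\<lambda>\<theta>. \<integral>\<^sup>+x. ennreal (p x \<theta>) * indicator A (x, \<theta>) \<partial>M) \<in> borel_measurable prior"
      by measurable
    then show "(\<lambda>\<theta>. emeasure (K \<theta>) A) \<in> borel_measurable prior"
      by (subst measurable_cong[where g = "\<lambda>\<theta>. \<integral>\<^sup>+x. ennreal (p x \<theta>) * indicator A (x, \<theta>) \<partial>M"])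
         (auto simp: emeasure_K)
  qed
  have joint: "joint = prior \<bind> K" unfolding joint_law_def K_def[abs_def] ..
  show ?thesis
  proof (rule measure_eqI)
    show "sets joint = sets (density N (\<lambda>(x, \<theta>). ennreal (p x \<theta> * g \<theta>)))"
      unfolding joint using prior.not_empty K_meas by (subst sets_bind) (auto simp: K)
    fix A assume "A \<in> sets joint"
    then have A[measurable]: "A \<in> sets N"
      unfolding joint using prior.not_empty by (subst (asm) sets_bind) (auto simp: K)
    have "emeasure joint A = (\<integral>\<^sup>+\<theta>. emeasure (K \<theta>) A \<partial>prior)"
      unfolding joint using prior.not_empty K_meas A by (rule emeasure_bind)
    also have "\<dots> = (\<integral>\<^sup>+\<theta>. (\<integral>\<^sup>+x. ennreal (p x \<theta>) * indicator A (x, \<theta>) \<partial>M) \<partial>prior)"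
      by (rule nn_integral_cong) (simp add: emeasure_K)
    also have "\<dots> = (\<integral>\<^sup>+\<theta>. ennreal (g \<theta>) * (\<integral>\<^sup>+x. ennreal (p x \<theta>) * indicator A (x, \<theta>) \<partial>M) \<partial>leb_on \<Theta>)"
      by (rule nn_integral_density) measurable
    also have "\<dots> = (\<integral>\<^sup>+\<theta>. (\<integral>\<^sup>+x. ennreal (p x \<theta> * g \<theta>) * indicator A (x, \<theta>) \<partial>M) \<partial>leb_on \<Theta>)"
      by (intro nn_integral_cong, subst nn_integral_cmult[symmetric])
         (auto intro!: nn_integral_cong simp: ennreal_mult p_nonneg g_nonneg mult_ac)
    also have "\<dots> = (\<integral>\<^sup>+w. (case w of (x, \<theta>) \<Rightarrow> ennreal (p x \<theta> * g \<theta>)) * indicator A w \<partial>N)"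
      by (subst nn_integral_snd[symmetric]) auto
    also have "\<dots> = emeasure (density N (\<lambda>(x, \<theta>). ennreal (p x \<theta> * g \<theta>))) A"
      by (subst emeasure_density) auto
    finally show "emeasure joint A = emeasure (density N (\<lambda>(x, \<theta>). ennreal (p x \<theta> * g \<theta>))) A" .
  qed
qed

lemma sets_joint[simp, measurable_cong]: "sets joint = sets N"
  by (simp add: joint_law_density)

lemma space_joint[simp]: "space joint = space M \<times> \<Theta>"
  by (simp add: joint_law_density space_pair_measure)

lemma emeasure_joint_space: "emeasure joint (space joint) = 1"
proof -
  interpret prior: prob_space prior by (rule prob_prior)
  have "emeasure joint (space joint)
      = (\<integral>\<^sup>+w. (case w of (x, \<theta>) \<Rightarrow> ennreal (p x \<theta> * g \<theta>)) \<partial>N)"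
    unfolding joint_law_density
    by (subst emeasure_density) (auto intro!: nn_integral_cong)
  also have "\<dots> = (\<integral>\<^sup>+\<theta>. (\<integral>\<^sup>+x. ennreal (p x \<theta> * g \<theta>) \<partial>M) \<partial>leb_on \<Theta>)"
    by (subst nn_integral_snd[symmetric]) auto
  also have "\<dots> = (\<integral>\<^sup>+\<theta>. ennreal (g \<theta>) \<partial>leb_on \<Theta>)"
  proof (rule nn_integral_cong)
    fix \<theta> assume "\<theta> \<in> space (leb_on \<Theta>)"
    then have \<theta>: "\<theta> \<in> \<Theta>" by simp
    interpret prob_space "density M (\<lambda>x. ennreal (p x \<theta>))" by (rule prob_p) fact
    have "(\<integral>\<^sup>+x. ennreal (p x \<theta> * g \<theta>) \<partial>M) = (\<integral>\<^sup>+x. ennreal (p x \<theta>) * ennreal (g \<theta>) \<partial>M)"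
      using \<theta> by (intro nn_integral_cong) (auto simp: ennreal_mult p_nonneg g_nonneg)
    also have "\<dots> = (\<integral>\<^sup>+x. ennreal (p x \<theta>) \<partial>M) * ennreal (g \<theta>)"
      using \<theta> by (subst nn_integral_multc) auto
    also have "(\<integral>\<^sup>+x. ennreal (p x \<theta>) \<partial>M) = 1"
      using emeasure_space_1 \<theta> by (simp add: emeasure_density cong: nn_integral_cong)
    finally show "(\<integral>\<^sup>+x. ennreal (p x \<theta> * g \<theta>) \<partial>M) = ennreal (g \<theta>)" by simp
  qed
  also have "\<dots> = (\<integral>\<^sup>+\<theta>. 1 \<partial>prior)"
    by (subst nn_integral_density) auto
  finally show ?thesis using prior.emeasure_space_1 by simp
qed

sublocale joint: prob_space joint
  by (rule prob_spaceI) (rule emeasure_joint_space)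

text \<open>The real-valued integral defining the marginal density defaults to zero where the integral
  diverges. Since the total mass is one, that happens only on a null set of data.\<close>

lemma AE_marg: "AE x in M. (\<integral>\<^sup>+\<theta>. ennreal (p x \<theta> * g \<theta>) \<partial>leb_on \<Theta>) = ennreal (marg x)"
proof -
  have "(\<integral>\<^sup>+x. (\<integral>\<^sup>+\<theta>. ennreal (p x \<theta> * g \<theta>) \<partial>leb_on \<Theta>) \<partial>M)
      = (\<integral>\<^sup>+w. (case w of (x, \<theta>) \<Rightarrow> ennreal (p x \<theta> * g \<theta>)) \<partial>N)"
    by (subst M2.nn_integral_fst[symmetric]) auto
  also have "\<dots> = emeasure joint (space joint)"
    unfolding joint_law_density
    by (subst emeasure_density) (auto intro!: nn_integral_cong)
  finally have "AE x in M. (\<integral>\<^sup>+\<theta>. ennreal (p x \<theta> * g \<theta>) \<partial>leb_on \<Theta>) \<noteq> \<infinity>"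
    by (intro nn_integral_PInf_AE) (auto simp: emeasure_joint_space)
  then show ?thesis
  proof (rule AE_mp, intro AE_I2 impI)
    fix x assume [measurable]: "x \<in> space M" and fin: "(\<integral>\<^sup>+\<theta>. ennreal (p x \<theta> * g \<theta>) \<partial>leb_on \<Theta>) \<noteq> \<infinity>"
    have nonneg: "AE \<theta> in leb_on \<Theta>. 0 \<le> p x \<theta> * g \<theta>"
      by (rule AE_I2) (auto simp: p_nonneg g_nonneg \<open>x \<in> space M\<close>)
    then have "integrable (leb_on \<Theta>) (\<lambda>\<theta>. p x \<theta> * g \<theta>)"
      using fin by (intro integrableI_nonneg) (auto simp: top.not_eq_extremum)
    then show "(\<integral>\<^sup>+\<theta>. ennreal (p x \<theta> * g \<theta>) \<partial>leb_on \<Theta>) = ennreal (marg x)"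
      unfolding marginal_density_def using nonneg by (rule nn_integral_eq_integral)
  qed
qed

text \<open>This measure weighs a region of the product space by the length of its sections, averaged
  over the marginal law of the data.\<close>

definition data_length :: "('x \<times> real) measure"
  where "data_length = density N (\<lambda>(x, \<theta>). ennreal (marg x))"

lemma sets_data_length[simp, measurable_cong]: "sets data_length = sets N"
  by (simp add: data_length_def)

lemma space_data_length[simp]: "space data_length = space M \<times> \<Theta>"
  by (simp add: data_length_def space_pair_measure)

text \<open>Where the marginal density is positive, multiplying the posterior density by it gives back
  the joint density. Where it vanishes the quotient is zero by convention, but there the
  joint density itself vanishes for almost every parameter.\<close>

lemma joint_density_posterior: "joint = density data_length (\<lambda>(x, \<theta>). ennreal (post \<theta> x))"
proof -
  have "AE x in M. AE \<theta> in leb_on \<Theta>. ennreal (p x \<theta> * g \<theta>) = ennreal (marg x) * ennreal (post \<theta> x)"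
  proof (rule AE_mp[OF AE_marg], rule AE_I2, rule impI)
    fix x assume x[measurable]: "x \<in> space M"
      and eq: "(\<integral>\<^sup>+\<theta>. ennreal (p x \<theta> * g \<theta>) \<partial>leb_on \<Theta>) = ennreal (marg x)"
    show "AE \<theta> in leb_on \<Theta>. ennreal (p x \<theta> * g \<theta>) = ennreal (marg x) * ennreal (post \<theta> x)"
    proof (cases "marg x = 0")
      case True
      have "(\<lambda>\<theta>. ennreal (p x \<theta> * g \<theta>)) \<in> borel_measurable (leb_on \<Theta>)"
        by measurable
      from nn_integral_0_iff_AE[OF this] eq True
      have "AE \<theta> in leb_on \<Theta>. ennreal (p x \<theta> * g \<theta>) = 0" by simp
      with True show ?thesis by simp
    next
      case False
      have "ennreal (p x \<theta> * g \<theta>) = ennreal (marg x) * ennreal (post \<theta> x)" if "\<theta> \<in> \<Theta>" for \<theta>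
      proof -
        have "p x \<theta> * g \<theta> = marg x * post \<theta> x" using False by (simp add: posterior_def)
        then show ?thesis using x that by (simp add: ennreal_mult marg_nonneg post_nonneg)
      qed
      then show ?thesis by (intro AE_I2) simp
    qed
  qed
  then have "AE w in N. (case w of (x, \<theta>) \<Rightarrow> ennreal (p x \<theta> * g \<theta>))
      = (case w of (x, \<theta>) \<Rightarrow> ennreal (marg x)) * (case w of (x, \<theta>) \<Rightarrow> ennreal (post \<theta> x))"
    by (intro AE_pair_measure) simp_all
  then show ?thesis
    unfolding joint_law_density data_length_def
    by (subst density_density_eq) (auto intro!: density_cong)
qed

section \<open>Coverage and expected length of a rule\<close>

lemma coverage_eq:
  assumes "J \<in> set_rules M \<Theta>"
  shows "coverage M \<Theta> p prior J = measure joint (Sigma (space M) J)"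
  unfolding coverage_def using assms
  by (intro arg_cong[of _ _ "measure joint"]) (auto simp: set_rules_def)

text \<open>The length of the section \<open>J x\<close> is constant in the parameter, so integrating out the
  parameter first leaves the marginal density times the length of the section.\<close>

lemma expected_length_eq:
  assumes J: "J \<in> set_rules M \<Theta>"
  shows "expected_length M \<Theta> p prior J = emeasure data_length (Sigma (space M) J)"
proof -
  let ?S = "Sigma (space M) J"
  define len where "len x = emeasure (leb_on \<Theta>) (Pair x -` ?S)" for x
  have S[measurable]: "?S \<in> sets N" and sub: "\<And>x. x \<in> space M \<Longrightarrow> J x \<subseteq> \<Theta>"
    using J by (auto simp: set_rules_def)
  have len_meas[measurable]: "len \<in> borel_measurable M"
    unfolding len_def by (rule M2.measurable_emeasure_Pair) fact
  have len: "emeasure lborel (J x) = len x" if "x \<in> space M" for x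
  proof -
    have "Pair x -` ?S = J x" using that by auto
    then show ?thesis
      using sub[OF that] Theta_borel by (simp add: len_def emeasure_restrict_space)
  qed
  have "expected_length M \<Theta> p prior J = (\<integral>\<^sup>+(x, \<theta>). len x \<partial>joint)"
    unfolding expected_length_def by (rule nn_integral_cong) (auto simp: len)
  also have "\<dots> = (\<integral>\<^sup>+w. (case w of (x, \<theta>) \<Rightarrow> ennreal (p x \<theta> * g \<theta>)) * (case w of (x, \<theta>) \<Rightarrow> len x) \<partial>N)"
    unfolding joint_law_density by (rule nn_integral_density) measurable
  also have "\<dots> = (\<integral>\<^sup>+x. (\<integral>\<^sup>+\<theta>. ennreal (p x \<theta> * g \<theta>) * len x \<partial>leb_on \<Theta>) \<partial>M)"
    by (subst M2.nn_integral_fst[symmetric]) auto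
  also have "\<dots> = (\<integral>\<^sup>+x. (\<integral>\<^sup>+\<theta>. ennreal (p x \<theta> * g \<theta>) \<partial>leb_on \<Theta>) * len x \<partial>M)"
    by (rule nn_integral_cong, rule nn_integral_multc) measurable
  also have "\<dots> = (\<integral>\<^sup>+x. ennreal (marg x) * len x \<partial>M)"
    using AE_marg by (intro nn_integral_cong_AE) auto
  also have "\<dots> = (\<integral>\<^sup>+x. (\<integral>\<^sup>+\<theta>. ennreal (marg x) * indicator ?S (x, \<theta>) \<partial>leb_on \<Theta>) \<partial>M)"
  proof (rule nn_integral_cong)
    fix x assume x[measurable]: "x \<in> space M"
    have "(\<integral>\<^sup>+\<theta>. ennreal (marg x) * indicator ?S (x, \<theta>) \<partial>leb_on \<Theta>)
        = (\<integral>\<^sup>+\<theta>. ennreal (marg x) * indicator (Pair x -` ?S) \<theta> \<partial>leb_on \<Theta>)"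
      by (rule nn_integral_cong) (auto split: split_indicator)
    also have "\<dots> = ennreal (marg x) * len x"
      unfolding len_def by (rule nn_integral_cmult_indicator) (rule sets_Pair1[OF S])
    finally show "ennreal (marg x) * len x
      = (\<integral>\<^sup>+\<theta>. ennreal (marg x) * indicator ?S (x, \<theta>) \<partial>leb_on \<Theta>)" by simp
  qed
  also have "\<dots> = (\<integral>\<^sup>+w. (case w of (x, \<theta>) \<Rightarrow> ennreal (marg x)) * indicator ?S w \<partial>N)"
    by (subst M2.nn_integral_fst[symmetric]) auto
  also have "\<dots> = emeasure data_length ?S"
    unfolding data_length_def by (rule emeasure_density[symmetric]) measurable
  finally show ?thesis .
qed

text \<open>The law of the parameter has a density with respect to Lebesgue measure, hence no atoms.
  This makes the parameter a coordinate along which level sets can be split.\<close>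

lemma joint_parameter_null: "measure joint {w \<in> space joint. snd w = t} = 0"
proof -
  have null: "emeasure (leb_on \<Theta>) ({t} \<inter> \<Theta>) = 0"
  proof -
    have "emeasure (leb_on \<Theta>) ({t} \<inter> \<Theta>) = emeasure lborel ({t} \<inter> \<Theta>)"
      using Theta_borel by (subst emeasure_restrict_space) auto
    also have "\<dots> \<le> emeasure lborel {t}" by (rule emeasure_mono) auto
    finally show ?thesis by simp
  qed
  have t: "{t} \<inter> \<Theta> \<in> sets (leb_on \<Theta>)"
    using Theta_borel by (auto simp: sets_restrict_space_iff)
  have "{w \<in> space N. snd w = t} = space M \<times> ({t} \<inter> \<Theta>)"
    by (auto simp: space_pair_measure)
  moreover have "space M \<times> ({t} \<inter> \<Theta>) \<in> null_sets N"
    using t by (intro null_setsI) (simp_all add: M2.emeasure_pair_measure_Times null)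
  ultimately have N: "{w \<in> space N. snd w = t} \<in> null_sets N" by simp
  then have "AE w in N. snd w \<noteq> t"
    by (subst AE_iff_null) auto
  then have "AE w in joint. snd w \<noteq> t"
    unfolding joint_law_density by (subst AE_density) auto
  then show ?thesis
    using null_setsD2[OF N] by (subst joint.prob_eq_0) (auto simp: space_pair_measure)
qed

text \<open>A nonnegative density is positive almost everywhere for the measure that it defines.\<close>

lemma AE_posterior_pos: "AE w in joint. 0 < post (snd w) (fst w)"
proof -
  have "AE w in data_length. 0 < ennreal (post (snd w) (fst w)) \<longrightarrow> 0 < post (snd w) (fst w)"
    by simp
  then show ?thesis
    unfolding joint_density_posterior by (subst AE_density) (auto simp: case_prod_beta)
qed

theorem highest_posterior_density_rule:
  assumes \<beta>: "0 < \<beta>" "\<beta> < 1"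
  defines "k \<equiv> kstar M \<Theta> p prior g \<beta>"
  shows "\<P>((x, \<theta>) in joint. post \<theta> x > k) \<le> 1 - \<beta>" (is ?upper)
    and "1 - \<beta> \<le> \<P>((x, \<theta>) in joint. post \<theta> x \<ge> k)" (is ?lower)
    and "\<exists>A \<in> sets N. A \<subseteq> {(x, \<theta>) \<in> space M \<times> \<Theta>. post \<theta> x = k} \<and>
      (let I = \<lambda>x. {\<theta> \<in> \<Theta>. post \<theta> x > k} \<union> {\<theta> \<in> \<Theta>. (x, \<theta>) \<in> A} in
        is_arg_min (expected_length M \<Theta> p prior)
          (\<lambda>J. J \<in> set_rules M \<Theta> \<and> coverage M \<Theta> p prior J \<ge> 1 - \<beta>) I \<and>
        coverage M \<Theta> p prior I = 1 - \<beta>)" (is ?rule)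
proof -
  define f where "f = (\<lambda>(x, \<theta>). post \<theta> x)"
  have f[measurable]: "f \<in> borel_measurable N" by (simp add: f_def)
  have fj: "f \<in> borel_measurable joint" by measurable
  have f_nonneg: "0 \<le> f w" if "w \<in> space joint" for w
    using that by (auto simp: f_def post_nonneg)
  have region: "{(x, \<theta>). (x, \<theta>) \<in> space joint \<and> t \<le> post \<theta> x} = {w \<in> space joint. t \<le> f w}"
      "{(x, \<theta>). (x, \<theta>) \<in> space joint \<and> t < post \<theta> x} = {w \<in> space joint. t < f w}" for t
    by (auto simp: f_def)
  have k: "k = Sup {k. 0 \<le> k \<and> 1 - \<beta> \<le> \<P>(w in joint. k \<le> f w)}"
    unfolding k_def kstar_def by (simp only: region)
  note q = joint.upper_quantile[OF fj f_nonneg _ _ k]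
  have up: "\<P>(w in joint. k < f w) \<le> 1 - \<beta>" and lo: "1 - \<beta> \<le> \<P>(w in joint. k \<le> f w)" and "0 \<le> k"
    using q \<beta> by auto
  show ?upper ?lower using up lo by (simp_all only: region)
  have "k \<noteq> 0"
  proof
    assume "k = 0"
    have pos: "{w \<in> space joint. 0 < f w} \<in> sets joint" using fj by measurable
    have "\<P>(w in joint. 0 < f w) = 1"
      using AE_posterior_pos by (subst joint.prob_Collect_eq_1) (use pos in \<open>simp_all add: f_def case_prod_beta\<close>)
    with up \<open>k = 0\<close> \<beta> show False by simp
  qed
  with \<open>0 \<le> k\<close> have "0 < k" by simp
  let ?U = "{w \<in> space joint. k < f w}" and ?E = "{w \<in> space joint. f w = k}"
  have UE[measurable]: "?U \<in> sets N" "?E \<in> sets N"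
    unfolding sets_joint[symmetric] using fj by measurable
  have "(\<lambda>\<theta>. \<theta>) \<in> borel_measurable (leb_on \<Theta>)"
    by (rule measurable_restrict_space1) simp
  then have snd_meas: "snd \<in> borel_measurable joint"
    using measurable_compose[of snd N] by simp
  have "{w \<in> space joint. k \<le> f w} = ?U \<union> ?E" by auto
  then have "\<P>(w in joint. k \<le> f w) = measure joint ?U + measure joint ?E"
    by (simp only:) (subst joint.finite_measure_Union, use UE in auto)
  then obtain A where A[measurable]: "A \<in> sets N" and AE: "A \<subseteq> ?E"
      and mA: "measure joint A = 1 - \<beta> - measure joint ?U"
    using joint.exists_subset_of_measure[OF snd_meas UE(2)[folded sets_joint] joint_parameter_null,
        of "1 - \<beta> - measure joint ?U"] up lo by auto
  \<comment> \<open>Adding \<open>A\<close> to the strict superlevel set brings the probability up to \<open>1 - \<beta>\<close>.\<close>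
  define I where "I = (\<lambda>x. {\<theta> \<in> \<Theta>. post \<theta> x > k} \<union> {\<theta> \<in> \<Theta>. (x, \<theta>) \<in> A})"
  have SI: "Sigma (space M) I = ?U \<union> A"
    using AE by (auto simp: I_def f_def)
  have I: "I \<in> set_rules M \<Theta>"
    using sets.Un[OF UE(1) A] unfolding set_rules_def mem_Collect_eq SI by (auto simp: I_def)
  have cov: "coverage M \<Theta> p prior I = 1 - \<beta>"
    unfolding coverage_eq[OF I] SI using AE mA UE by (subst joint.finite_measure_Union) auto
  have "expected_length M \<Theta> p prior I \<le> expected_length M \<Theta> p prior J"
    if J: "J \<in> set_rules M \<Theta>" and covJ: "1 - \<beta> \<le> coverage M \<Theta> p prior J" for J
    unfolding expected_length_eq[OF I] expected_length_eq[OF J]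
  proof (rule superlevel_set_minimal[where f = f and k = k])
    have joint: "density data_length f = joint"
      unfolding joint_density_posterior
      by (intro arg_cong[of _ _ "density data_length"] ext) (auto simp: f_def)
    show "f \<in> borel_measurable data_length" by measurable
    show "0 < k" by fact
    show "emeasure (density data_length f) (Sigma (space M) I)
        \<le> emeasure (density data_length f) (Sigma (space M) J)"
      unfolding joint using cov covJ
      by (simp add: coverage_eq I J joint.emeasure_eq_measure)
    show "emeasure (density data_length f) (Sigma (space M) I) < \<infinity>"
      unfolding joint by (simp add: joint.emeasure_eq_measure)
    show "Sigma (space M) I \<in> sets data_length" "Sigma (space M) J \<in> sets data_length"
      using I J by (auto simp: set_rules_def)
    show "k \<le> f w" if "w \<in> Sigma (space M) I" for w
      using that AE unfolding SI by auto
    show "f w \<le> k" if "w \<in> space data_length - Sigma (space M) I" for w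
      using that unfolding SI by auto
  qed
  then have "is_arg_min (expected_length M \<Theta> p prior)
      (\<lambda>J. J \<in> set_rules M \<Theta> \<and> coverage M \<Theta> p prior J \<ge> 1 - \<beta>) I"
    using I cov by (auto simp: is_arg_min_def not_less)
  moreover have "A \<subseteq> {(x, \<theta>) \<in> space M \<times> \<Theta>. post \<theta> x = k}"
    using AE by (auto simp: f_def)
  ultimately show ?rule
    using A cov unfolding Let_def I_def by blast
qed

end

theorem theorem3p1:
  fixes M :: "'x measure" and \<Theta> :: "real set"
    and p :: "'x \<Rightarrow> real \<Rightarrow> real" and G :: "real measure" and g :: "real \<Rightarrow> real" and \<beta> :: real
  assumes "sigma_finite_measure M"
    and "\<Theta> \<in> sets borel"
    and "(\<lambda>(x, \<theta>). p x \<theta>) \<in> borel_measurable (M \<Otimes>\<^sub>M leb_on \<Theta>)"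
    and "\<And>x \<theta>. x \<in> space M \<Longrightarrow> \<theta> \<in> \<Theta> \<Longrightarrow> 0 \<le> p x \<theta>"
    and "\<And>\<theta>. \<theta> \<in> \<Theta> \<Longrightarrow> prob_space (density M (\<lambda>x. ennreal (p x \<theta>)))"
    and "prob_space G"
    and "g \<in> borel_measurable (leb_on \<Theta>)"
    and "\<And>\<theta>. \<theta> \<in> \<Theta> \<Longrightarrow> 0 \<le> g \<theta>"
    and "G = density (leb_on \<Theta>) (\<lambda>\<theta>. ennreal (g \<theta>))"
    and "0 < \<beta>" and "\<beta> < 1"
  defines "P \<equiv> joint_law M \<Theta> p G"
    and "\<pi> \<equiv> posterior \<Theta> p g"
    and "k \<equiv> kstar M \<Theta> p G g \<beta>"
  shows "\<P>((x, \<theta>) in P. \<pi> \<theta> x > k) \<le> 1 - \<beta> \<and>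
    1 - \<beta> \<le> \<P>((x, \<theta>) in P. \<pi> \<theta> x \<ge> k) \<and>
    (\<exists>A \<in> sets (M \<Otimes>\<^sub>M leb_on \<Theta>).
      A \<subseteq> {(x, \<theta>) \<in> space M \<times> \<Theta>. \<pi> \<theta> x = k} \<and>
      (let I = \<lambda>x. {\<theta> \<in> \<Theta>. \<pi> \<theta> x > k} \<union> {\<theta> \<in> \<Theta>. (x, \<theta>) \<in> A} in
        is_arg_min (expected_length M \<Theta> p G)
          (\<lambda>J. J \<in> set_rules M \<Theta> \<and> coverage M \<Theta> p G J \<ge> 1 - \<beta>) I \<and>
        coverage M \<Theta> p G I = 1 - \<beta>))"
proof -
  have prior: "prob_space (density (leb_on \<Theta>) (\<lambda>\<theta>. ennreal (g \<theta>)))"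
    using assms(6,9) by simp
  interpret bayes_model M \<Theta> p g
    by (intro bayes_model.intro assms(1-5,7,8) prior)
  show ?thesis
    unfolding P_def \<pi>_def k_def assms(9)
    by (intro conjI highest_posterior_density_rule \<open>0 < \<beta>\<close> \<open>\<beta> < 1\<close>)
qed

end
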